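(* The Least Unpopular Reselection (LUR) procedure, for elections with at least three alternatives, satisfies the always-a-winner condition (AAW), monotonicity, the Pareto condition, and the social disappointment criterion (SDC) (for every finite $A$ with $|A|\ge 3$ and every positive integer $n$), but it does not satisfy the Condorcet winner criterion (CWC), the Condorcet loser criterion (CLC), or independence of irrelevant alternatives (IIA) (that is, each of these three criteria is violated for some finite $A$ with $|A|\ge 3$ and some positive integer $n$).
   Context: A ballot is a linear ordering of the finite set $A$ of alternatives (a strict ranking without ties). An $(A,n)$-profile $P$ is an $n$-tuple of ballots, one for each voter in $N=\{1,\dots,n\}$. A voting rule $V$ assigns to each $(A,n)$-profile $P$ a subset $V(P)\subseteq A$. $W(x,y,P)$ is the number of voters ranking $x$ above $y$ in $P$. LUR: for a nonempty $S\subseteq A$, let $P|_S$ be the profile obtained by restricting each ballot to $S$, and let $V_{LU}(P|_S)$ be the set of alternatives of $S$ ranked last (among $S$) by the fewest voters. Put $W_0=A$ and $W_{k+1}=V_{LU}(P|_{W_k})$. This decreasing sequence of nonempty sets becomes constant, and $\mathrm{LUR}(P)$ is its eventual value, $W_{|A|}$. Criteria for $V$: - AAW: $V(P)\ne\emptyset$ for every profile $P$. - Monotonicity: whenever $x\in V(P)$ and $Q$ is obtained from $P$ by one voter moving $x$ up on his or her ballot (all other ballots, and the relative order of the other alternatives on that voter's ballot, being unchanged), then $x\in V(Q)$. - Pareto: if every voter ranks $x$ above $y$ in $P$, then $y\notin V(P)$. - SDC: if at least $n/2$ of the $n$ voters rank $x$ last in $P$, then $x\notin V(P)$. - CWC: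 call $x$ a Condorcet winner at $P$ if it is the unique alternative with $W(x,y,P)\ge W(y,x,P)$ for all $y\in A$; CWC says that if $x$ is a Condorcet winner at $P$ then $V(P)=\{x\}$. - CLC: if $W(x,y,P)<W(y,x,P)$ for all $y\in A\setminus\{x\}$ (i.e. $x$ is a Condorcet loser), then $x\notin V(P)$. - IIA: for all profiles $P,P'$ and all $x,y\in A$, if $x\in V(P)$, $y\notin V(P)$ and every voter ranks $x$ and $y$ in the same relative order in $P$ and $P'$, then $y\notin V(P')$. *)

theory Defs
  imports Complex_Main "HOL-Library.FuncSet"
begin

text \<open>
  Ballots are strict orders: \<open>(x, y) \<in> r\<close> means that \<open>x\<close> is ranked above \<open>y\<close>.
  As \<^const>\<open>strict_linear_order_on\<close> does not bound the field of the relation, the inclusion in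
  \<open>A \<times> A\<close> is required separately.
\<close>

type_synonym 'a ballot = "'a rel"
type_synonym 'a profile = "nat \<Rightarrow> 'a ballot"
type_synonym 'a voting_rule = "'a profile \<Rightarrow> 'a set"

definition ballots :: "'a set \<Rightarrow> 'a ballot set" where
  "ballots A = {r. r \<subseteq> A \<times> A \<and> strict_linear_order_on A r}"

definition voters :: "nat \<Rightarrow> nat set" where
  "voters n = {1..n}"

definition profiles :: "'a set \<Rightarrow> nat \<Rightarrow> 'a profile set" where
  "profiles A n = voters n \<rightarrow>\<^sub>E ballots A"

definition num_above :: "nat \<Rightarrow> 'a \<Rightarrow> 'a \<Rightarrow> 'a profile \<Rightarrow> nat" where
  "num_above n x y P = card {i \<in> voters n. (x, y) \<in> P i}"

definition ranked_last :: "'a set \<Rightarrow> 'a ballot \<Rightarrow> 'a \<Rightarrow> bool" where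
  "ranked_last S r x \<longleftrightarrow> x \<in> S \<and> (\<forall>y\<in>S - {x}. (y, x) \<in> r)"

definition num_last :: "'a set \<Rightarrow> nat \<Rightarrow> 'a profile \<Rightarrow> 'a \<Rightarrow> nat" where
  "num_last S n P x = card {i \<in> voters n. ranked_last S (P i) x}"


subsection \<open>Least Unpopular Reselection\<close>

definition restrict_profile :: "nat \<Rightarrow> 'a profile \<Rightarrow> 'a set \<Rightarrow> 'a profile" where
  "restrict_profile n P S = (\<lambda>i\<in>voters n. P i \<inter> S \<times> S)"

definition least_unpopular :: "'a set \<Rightarrow> nat \<Rightarrow> 'a voting_rule" where
  "least_unpopular S n P = {x \<in> S. \<forall>y\<in>S. num_last S n P x \<le> num_last S n P y}"

primrec LUR_stage :: "'a set \<Rightarrow> nat \<Rightarrow> 'a profile \<Rightarrow> nat \<Rightarrow> 'a set" where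
  "LUR_stage A n P 0 = A"
| "LUR_stage A n P (Suc k) =
     least_unpopular (LUR_stage A n P k) n (restrict_profile n P (LUR_stage A n P k))"

definition LUR :: "'a set \<Rightarrow> nat \<Rightarrow> 'a voting_rule" where
  "LUR A n P = LUR_stage A n P (card A)"


subsection \<open>Criteria\<close>

definition always_a_winner :: "'a set \<Rightarrow> nat \<Rightarrow> 'a voting_rule \<Rightarrow> bool" where
  "always_a_winner A n V \<longleftrightarrow> (\<forall>P\<in>profiles A n. V P \<noteq> {})"

definition moves_up :: "'a \<Rightarrow> 'a ballot \<Rightarrow> 'a ballot \<Rightarrow> bool" where
  "moves_up x r s \<longleftrightarrow>
     {y. (x, y) \<in> r} \<subset> {y. (x, y) \<in> s} \<and>
     (\<forall>y z. y \<noteq> x \<and> z \<noteq> x \<longrightarrow> ((y, z) \<in> r \<longleftrightarrow> (y, z) \<in> s))"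

definition monotonicity :: "'a set \<Rightarrow> nat \<Rightarrow> 'a voting_rule \<Rightarrow> bool" where
  "monotonicity A n V \<longleftrightarrow>
     (\<forall>P\<in>profiles A n. \<forall>Q\<in>profiles A n. \<forall>x\<in>V P. \<forall>i\<in>voters n.
        moves_up x (P i) (Q i) \<and> (\<forall>j\<in>voters n - {i}. Q j = P j) \<longrightarrow> x \<in> V Q)"

definition pareto :: "'a set \<Rightarrow> nat \<Rightarrow> 'a voting_rule \<Rightarrow> bool" where
  "pareto A n V \<longleftrightarrow>
     (\<forall>P\<in>profiles A n. \<forall>x\<in>A. \<forall>y\<in>A. (\<forall>i\<in>voters n. (x, y) \<in> P i) \<longrightarrow> y \<notin> V P)"

definition social_disappointment_criterion :: "'a set \<Rightarrow> nat \<Rightarrow> 'a voting_rule \<Rightarrow> bool" where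
  "social_disappointment_criterion A n V \<longleftrightarrow>
     (\<forall>P\<in>profiles A n. \<forall>x\<in>A. real (num_last A n P x) \<ge> real n / 2 \<longrightarrow> x \<notin> V P)"

definition weakly_unbeaten :: "'a set \<Rightarrow> nat \<Rightarrow> 'a profile \<Rightarrow> 'a \<Rightarrow> bool" where
  "weakly_unbeaten A n P x \<longleftrightarrow> x \<in> A \<and> (\<forall>y\<in>A. num_above n x y P \<ge> num_above n y x P)"

definition condorcet_winner :: "'a set \<Rightarrow> nat \<Rightarrow> 'a profile \<Rightarrow> 'a \<Rightarrow> bool" where
  "condorcet_winner A n P x \<longleftrightarrow>
     weakly_unbeaten A n P x \<and> (\<forall>z. weakly_unbeaten A n P z \<longrightarrow> z = x)"

definition condorcet_winner_criterion :: "'a set \<Rightarrow> nat \<Rightarrow> 'a voting_rule \<Rightarrow> bool" where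
  "condorcet_winner_criterion A n V \<longleftrightarrow>
     (\<forall>P\<in>profiles A n. \<forall>x. condorcet_winner A n P x \<longrightarrow> V P = {x})"

definition condorcet_loser :: "'a set \<Rightarrow> nat \<Rightarrow> 'a profile \<Rightarrow> 'a \<Rightarrow> bool" where
  "condorcet_loser A n P x \<longleftrightarrow> x \<in> A \<and> (\<forall>y\<in>A - {x}. num_above n x y P < num_above n y x P)"

definition condorcet_loser_criterion :: "'a set \<Rightarrow> nat \<Rightarrow> 'a voting_rule \<Rightarrow> bool" where
  "condorcet_loser_criterion A n V \<longleftrightarrow>
     (\<forall>P\<in>profiles A n. \<forall>x. condorcet_loser A n P x \<longrightarrow> x \<notin> V P)"

definition independence_of_irrelevant_alternatives ::
    "'a set \<Rightarrow> nat \<Rightarrow> 'a voting_rule \<Rightarrow> bool" where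
  "independence_of_irrelevant_alternatives A n V \<longleftrightarrow>
     (\<forall>P\<in>profiles A n. \<forall>P'\<in>profiles A n. \<forall>x\<in>A. \<forall>y\<in>A.
        x \<in> V P \<and> y \<notin> V P \<and> (\<forall>i\<in>voters n. (x, y) \<in> P i \<longleftrightarrow> (x, y) \<in> P' i) \<longrightarrow> y \<notin> V P')"


subsection \<open>The stages of the procedure\<close>

lemma restrict_profile_in_profiles:
  assumes "P \<in> profiles A n" and "S \<subseteq> A"
  shows "restrict_profile n P S \<in> profiles S n"
proof -
  have "P i \<inter> S \<times> S \<in> ballots S" if "i \<in> voters n" for i
  proof -
    have "P i \<in> ballots A"
      using assms(1) that by (auto simp: profiles_def)
    hence "trans (P i)" "irrefl (P i)" "total_on A (P i)"
      by (auto simp: ballots_def strict_linear_order_on_def)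
    with \<open>S \<subseteq> A\<close> show ?thesis
      by (auto simp: ballots_def strict_linear_order_on_def irrefl_def total_on_def subset_iff
               intro: trans_Restr)
  qed
  thus ?thesis
    by (auto simp: restrict_profile_def profiles_def)
qed

lemma LUR_stage_Suc_subset: "LUR_stage A n P (Suc k) \<subseteq> LUR_stage A n P k"
  by (auto simp: least_unpopular_def)

lemma LUR_stage_stable:
  assumes "LUR_stage A n P (Suc k) = LUR_stage A n P k" and "k \<le> m"
  shows "LUR_stage A n P m = LUR_stage A n P k"
  using assms(2)
proof (induction m rule: dec_induct)
  case (step m)
  have "LUR_stage A n P (Suc m) = LUR_stage A n P (Suc k)"
    by (simp add: step.IH)
  with assms(1) show ?case
    by (rule trans[rotated -1])
qed simp

end

theory Submission
  imports Defs
begin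

text \<open>
  The numbers of last places within a stage add up to \<open>n\<close>. An alternative ranked last by at least
  half of the voters is therefore above the average on three or more alternatives and is discarded
  in the first round. A Pareto dominated alternative can survive a stage only together with its
  dominator, which has no last places there; in the final stage, where all the numbers of last
  places agree, they would then all vanish. For monotonicity, raising \<open>x\<close> on one ballot changes a
  stage containing \<open>x\<close> only if \<open>x\<close> gives up a last place, and then \<open>x\<close> is the sole least unpopular
  alternative.
\<close>

section \<open>Ballots as strict linear orders\<close>

lemma ballots_trans: "\<lbrakk>r \<in> ballots A; (x, y) \<in> r; (y, z) \<in> r\<rbrakk> \<Longrightarrow> (x, z) \<in> r"
  by (auto simp: ballots_def strict_linear_order_on_def dest: transD)

lemma ballots_irrefl: "r \<in> ballots A \<Longrightarrow> (x, x) \<notin> r"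
  by (auto simp: ballots_def strict_linear_order_on_def irrefl_def)

lemma ballots_asym: "\<lbrakk>r \<in> ballots A; (x, y) \<in> r\<rbrakk> \<Longrightarrow> (y, x) \<notin> r"
  using ballots_trans ballots_irrefl by metis

lemma ballots_total: "\<lbrakk>r \<in> ballots A; x \<in> A; y \<in> A; x \<noteq> y\<rbrakk> \<Longrightarrow> (x, y) \<in> r \<or> (y, x) \<in> r"
  by (auto simp: ballots_def strict_linear_order_on_def total_on_def)

lemma profiles_ballot: "\<lbrakk>P \<in> profiles A n; i \<in> voters n\<rbrakk> \<Longrightarrow> P i \<in> ballots A"
  by (auto simp: profiles_def)

lemma finite_voters [simp]: "finite (voters n)"
  by (simp add: voters_def)

lemma card_voters [simp]: "card (voters n) = n"
  by (simp add: voters_def)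

subsection \<open>Last places\<close>

lemma ranked_last_unique:
  "\<lbrakk>r \<in> ballots A; ranked_last S r x; ranked_last S r y\<rbrakk> \<Longrightarrow> x = y"
  using ballots_asym unfolding ranked_last_def by fast

lemma ranked_last_exists:
  assumes r: "r \<in> ballots A" and "finite S" "S \<noteq> {}" "S \<subseteq> A"
  shows "\<exists>x. ranked_last S r x"
  using assms(2-)
proof (induction S rule: finite_ne_induct)
  case (singleton a)
  show ?case by (auto simp: ranked_last_def)
next
  case (insert a S)
  then obtain m where m: "ranked_last S r m" by auto
  hence "m \<in> S" "m \<noteq> a" "m \<in> A" "a \<in> A"
    using insert by (auto simp: ranked_last_def)
  \<comment> \<open>The lower of the new element \<open>a\<close> and the previous last element
    \<open>m\<close> is last in the enlarged set; if it is \<open>a\<close>, transitivity through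
    \<open>m\<close> puts all of \<open>S\<close> above it.\<close>
  with ballots_total[OF r] consider "(a, m) \<in> r" | "(m, a) \<in> r" by metis
  thus ?case
  proof cases
    case 1
    with m have "ranked_last (insert a S) r m" by (auto simp: ranked_last_def)
    thus ?thesis ..
  next
    case 2
    have "(y, a) \<in> r" if "y \<in> S" for y
      using m 2 that ballots_trans[OF r, of y m a] by (cases "y = m") (auto simp: ranked_last_def)
    hence "ranked_last (insert a S) r a" by (auto simp: ranked_last_def)
    thus ?thesis ..
  qed
qed

text \<open>Each ballot has exactly one last alternative in \<open>S\<close>, so the sets of voters
  counted for the different alternatives partition the electorate.\<close>

lemma sum_num_last:
  assumes P: "P \<in> profiles A n" and S: "finite S" "S \<noteq> {}" "S \<subseteq> A"
  shows "(\<Sum>x\<in>S. num_last S n P x) = n"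
proof -
  let ?I = "\<lambda>x. {i \<in> voters n. ranked_last S (P i) x}"
  have "(\<Sum>x\<in>S. num_last S n P x) = card (\<Union>x\<in>S. ?I x)"
    unfolding num_last_def
    using ranked_last_unique[OF profiles_ballot[OF P]]
    by (intro card_UN_disjoint[symmetric] S(1)) (simp, blast)
  also have "(\<Union>x\<in>S. ?I x) = voters n"
    using ranked_last_exists[OF profiles_ballot[OF P] S] by (fastforce simp: ranked_last_def)
  finally show ?thesis by simp
qed

lemma num_last_restrict_profile: "num_last S n (restrict_profile n P S) x = num_last S n P x"
  unfolding num_last_def
  by (rule arg_cong[where f = card]) (auto simp: restrict_profile_def ranked_last_def)

lemma least_unpopular_nonempty:
  assumes "finite S" "S \<noteq> {}"
  shows "least_unpopular S n P \<noteq> {}"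
proof -
  obtain x where "x \<in> S" "\<forall>y\<in>S. num_last S n P x \<le> num_last S n P y"
    using arg_min_if_finite(1)[OF assms, of "num_last S n P"]
      arg_min_least[OF assms, of _ "num_last S n P"] by blast
  thus ?thesis by (auto simp: least_unpopular_def)
qed

lemma least_unpopular_eq_singletonI:
  assumes "x \<in> S" "\<And>y. y \<in> S \<Longrightarrow> y \<noteq> x \<Longrightarrow> num_last S n P x < num_last S n P y"
  shows "least_unpopular S n P = {x}"
proof (intro set_eqI iffI)
  fix y assume "y \<in> least_unpopular S n P"
  thus "y \<in> {x}"
    using assms by (force simp: least_unpopular_def)
next
  fix y assume "y \<in> {x}"
  moreover have "num_last S n P x \<le> num_last S n P z" if "z \<in> S" for z
    using assms(2)[of z] that by (cases "z = x") auto
  ultimately show "y \<in> least_unpopular S n P"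
    using assms(1) by (auto simp: least_unpopular_def)
qed

text \<open>The minimum of the numbers of last places is at most their average, and their sum is
  \<open>n\<close>.\<close>

lemma card_mult_least_unpopular_le:
  assumes "P \<in> profiles A n" "finite S" "S \<subseteq> A" "x \<in> least_unpopular S n P"
  shows "card S * num_last S n P x \<le> n"
proof -
  have "card S * num_last S n P x \<le> (\<Sum>y\<in>S. num_last S n P y)"
    using sum_bounded_below[of S "num_last S n P x" "num_last S n P"] assms(4)
    by (simp add: least_unpopular_def)
  also have "\<dots> = n"
    using assms by (intro sum_num_last) (auto simp: least_unpopular_def)
  finally show ?thesis .
qed

subsection \<open>Stages of the procedure\<close>

declare LUR_stage.simps(2) [simp del]

text \<open>Being last in \<open>S\<close> depends only on pairs within \<open>S\<close>, so every
  round can be read off the original profile.\<close>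

lemma LUR_stage_Suc: "LUR_stage A n P (Suc k) = least_unpopular (LUR_stage A n P k) n P"
  by (simp add: LUR_stage.simps(2) least_unpopular_def num_last_restrict_profile)

lemma LUR_stage_antimono: "k \<le> m \<Longrightarrow> LUR_stage A n P m \<subseteq> LUR_stage A n P k"
  by (rule lift_Suc_antimono_le) (rule LUR_stage_Suc_subset)

lemma LUR_stage_subset: "LUR_stage A n P k \<subseteq> A"
  using LUR_stage_antimono[of 0 k A n P] by simp

lemma finite_LUR_stage: "finite A \<Longrightarrow> finite (LUR_stage A n P k)"
  using LUR_stage_subset finite_subset by metis

lemma LUR_stage_nonempty:
  assumes "finite A" "A \<noteq> {}"
  shows "LUR_stage A n P k \<noteq> {}"
proof (induction k)
  case (Suc k)
  thus ?case
    unfolding LUR_stage_Suc by (intro least_unpopular_nonempty finite_LUR_stage assms)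
qed (simp add: assms)

text \<open>As long as the stages keep changing, each round removes at least one alternative. At
  \<open>k = card A\<close> the second disjunct is impossible, so \<open>card A\<close> rounds
  suffice to reach a fixed point.\<close>

lemma LUR_stage_decreases_or_stable:
  assumes "finite A"
  shows "LUR_stage A n P (Suc k) = LUR_stage A n P k \<or>
    card (LUR_stage A n P (Suc k)) + Suc k \<le> card A"
proof (induction k)
  case 0
  show ?case
    using psubset_card_mono[OF assms, of "LUR_stage A n P (Suc 0)"]
      LUR_stage_subset[of A n P "Suc 0"]
    by (cases "LUR_stage A n P (Suc 0) = A") (simp_all add: psubset_eq)
next
  case (Suc k)
  show ?case
  proof (cases "LUR_stage A n P (Suc (Suc k)) = LUR_stage A n P (Suc k)")
    case False
    \<comment> \<open>Once two consecutive stages agree, all later ones do; a round that discards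
      something is therefore preceded only by such rounds.\<close>
    have "LUR_stage A n P (Suc k) \<noteq> LUR_stage A n P k"
    proof
      assume eq: "LUR_stage A n P (Suc k) = LUR_stage A n P k"
      hence "LUR_stage A n P (Suc (Suc k)) = LUR_stage A n P k" by (rule LUR_stage_stable) simp
      with eq False show False by simp
    qed
    moreover have "card (LUR_stage A n P (Suc (Suc k))) < card (LUR_stage A n P (Suc k))"
      using False LUR_stage_Suc_subset[of A n P "Suc k"]
      by (intro psubset_card_mono finite_LUR_stage assms) blast
    ultimately show ?thesis using Suc by linarith
  qed blast
qed

lemma least_unpopular_LUR:
  assumes "finite A"
  shows "least_unpopular (LUR A n P) n P = LUR A n P"
  using LUR_stage_decreases_or_stable[OF assms, of n P "card A"]
  unfolding LUR_def LUR_stage_Suc by auto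

lemma LUR_subset_least_unpopular:
  assumes "finite A" "A \<noteq> {}"
  shows "LUR A n P \<subseteq> least_unpopular A n P"
  using LUR_stage_antimono[of "Suc 0" "card A" A n P] assms
  by (simp add: LUR_def LUR_stage_Suc Suc_le_eq card_gt_0_iff)

lemma LUR_nonempty: "finite A \<Longrightarrow> A \<noteq> {} \<Longrightarrow> LUR A n P \<noteq> {}"
  unfolding LUR_def by (rule LUR_stage_nonempty)

text \<open>A strict minimum of last places decides the outcome in the first round. The
  counterexamples below are all of this kind.\<close>

lemma LUR_eq_singletonI:
  assumes "finite A" "x \<in> A" "\<And>y. y \<in> A \<Longrightarrow> y \<noteq> x \<Longrightarrow> num_last A n P x < num_last A n P y"
  shows "LUR A n P = {x}"
proof -
  have "least_unpopular A n P = {x}"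
    using assms(2,3) by (rule least_unpopular_eq_singletonI)
  thus ?thesis
    using LUR_subset_least_unpopular[of A n P] LUR_nonempty[of A n P] assms(1,2)
    by (metis empty_iff subset_singletonD)
qed

subsection \<open>Criteria satisfied\<close>

lemma LUR_always_a_winner: "finite A \<Longrightarrow> A \<noteq> {} \<Longrightarrow> always_a_winner A n (LUR A n)"
  by (simp add: always_a_winner_def LUR_nonempty)

lemma LUR_social_disappointment_criterion:
  assumes "finite A" "card A \<ge> 3" "n \<ge> 1"
  shows "social_disappointment_criterion A n (LUR A n)"
  unfolding social_disappointment_criterion_def
proof (intro ballI impI notI)
  fix P x assume P: "P \<in> profiles A n" and half: "real (num_last A n P x) \<ge> real n / 2"
    and x: "x \<in> LUR A n P"
  have "A \<noteq> {}" using assms(2) by auto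
  hence "card A * num_last A n P x \<le> n"
    using card_mult_least_unpopular_le[OF P assms(1) order_refl]
      LUR_subset_least_unpopular[OF assms(1)] x by blast
  \<comment> \<open>With at least \<open>n / 2\<close> last places for \<open>x\<close>, three times
    that number exceeds the positive number \<open>n\<close>.\<close>
  moreover have "3 * num_last A n P x \<le> card A * num_last A n P x"
    using assms(2) by (rule mult_right_mono) simp
  ultimately show False using half assms(3) by linarith
qed

text \<open>On every ballot \<open>y\<close> lies in \<open>S\<close> below \<open>x\<close>, which
  keeps \<open>x\<close> from being last there.\<close>

lemma num_last_dominator:
  assumes P: "P \<in> profiles A n" and dom: "\<And>i. i \<in> voters n \<Longrightarrow> (x, y) \<in> P i"
    and "y \<in> S" "x \<noteq> y"
  shows "num_last S n P x = 0"
proof -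
  have "\<not> ranked_last S (P i) x" if "i \<in> voters n" for i
    using ballots_asym[OF profiles_ballot[OF P that] dom[OF that]] assms(3,4)
    by (auto simp: ranked_last_def)
  thus ?thesis by (simp add: num_last_def)
qed

lemma LUR_pareto:
  assumes A: "finite A" "A \<noteq> {}" and n: "n \<ge> 1"
  shows "pareto A n (LUR A n)"
  unfolding pareto_def
proof (intro ballI impI notI)
  fix P x y assume P: "P \<in> profiles A n" and xy: "x \<in> A" "y \<in> A"
    and dom: "\<forall>i\<in>voters n. (x, y) \<in> P i" and y: "y \<in> LUR A n P"
  have "1 \<in> voters n" using n by (simp add: voters_def)
  hence "x \<noteq> y"
    using dom ballots_irrefl[OF profiles_ballot[OF P]] by blast
  hence zero: "num_last S n P x = 0" if "y \<in> S" for S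
    using num_last_dominator[OF P] dom that by blast
  \<comment> \<open>While \<open>y\<close> is present, \<open>x\<close> has no last places, which is
    the least possible number, so \<open>x\<close> survives every round that \<open>y\<close>
    survives.\<close>
  have "x \<in> LUR_stage A n P k" if "y \<in> LUR_stage A n P k" for k
    using that
  proof (induction k)
    case (Suc k)
    hence "y \<in> LUR_stage A n P k" using LUR_stage_Suc_subset[of A n P k] by blast
    with Suc.IH zero show ?case
      by (simp add: LUR_stage_Suc least_unpopular_def)
  qed (simp add: xy)
  hence "x \<in> LUR A n P" using y by (simp add: LUR_def)
  \<comment> \<open>The outcome is a fixed point, so all its members have as many last places as
    \<open>x\<close>, namely none; yet these numbers must add up to \<open>n\<close>.\<close>
  hence "num_last (LUR A n P) n P z = 0" if "z \<in> LUR A n P" for z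
    using least_unpopular_LUR[OF A(1), of n P] zero[OF y] that
    unfolding least_unpopular_def by (metis (lifting) le_zero_eq mem_Collect_eq)
  hence "(\<Sum>z\<in>LUR A n P. num_last (LUR A n P) n P z) = 0" by simp
  moreover have "(\<Sum>z\<in>LUR A n P. num_last (LUR A n P) n P z) = n"
    using LUR_nonempty[OF A] unfolding LUR_def
    by (intro sum_num_last[OF P] finite_LUR_stage[OF A(1)] LUR_stage_subset)
  ultimately show False using n by simp
qed

section \<open>Monotonicity: raising one alternative on a single ballot\<close>

lemma moves_up_above: "moves_up x r s \<Longrightarrow> (x, y) \<in> r \<Longrightarrow> (x, y) \<in> s"
  by (auto simp: moves_up_def)

lemma moves_up_others: "moves_up x r s \<Longrightarrow> y \<noteq> x \<Longrightarrow> z \<noteq> x \<Longrightarrow> (y, z) \<in> s \<longleftrightarrow> (y, z) \<in> r"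
  by (auto simp: moves_up_def)

lemma ranked_last_moves_up_eq:
  assumes r: "r \<in> ballots A" and s: "s \<in> ballots A" and mv: "moves_up x r s"
    and S: "finite S" "S \<subseteq> A" and x: "x \<in> S"
    and keep: "ranked_last S r x \<Longrightarrow> ranked_last S s x"
  shows "ranked_last S s z \<longleftrightarrow> ranked_last S r z"
proof -
  have imp: "ranked_last S s y" if y: "ranked_last S r y" for y
  proof (cases "y = x")
    case False
    have "(w, y) \<in> s" if "w \<in> S - {y}" for w
      using y that False moves_up_above[OF mv] moves_up_others[OF mv]
      by (cases "w = x") (auto simp: ranked_last_def)
    thus ?thesis using y by (simp add: ranked_last_def)
  qed (use y keep in simp)
  \<comment> \<open>The last element \<open>m\<close> for \<open>r\<close> is also last for
    \<open>s\<close>; uniqueness then turns the implication into an equivalence.\<close>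
  obtain m where "ranked_last S r m"
    using ranked_last_exists[OF r S(1) _ S(2)] x by blast
  thus ?thesis
    using imp ranked_last_unique[OF s] by blast
qed

lemma least_unpopular_moves_up:
  assumes P: "P \<in> profiles A n" and Q: "Q \<in> profiles A n" and i: "i \<in> voters n"
    and mv: "moves_up x (P i) (Q i)" and rest: "\<And>j. j \<in> voters n - {i} \<Longrightarrow> Q j = P j"
    and S: "finite S" "S \<subseteq> A" and x: "x \<in> least_unpopular S n P"
  shows "least_unpopular S n Q = least_unpopular S n P \<or> least_unpopular S n Q = {x}"
proof (cases "ranked_last S (P i) x \<longrightarrow> ranked_last S (Q i) x")
  case True
  have "x \<in> S" using x by (simp add: least_unpopular_def)
  hence "ranked_last S (Q i) z \<longleftrightarrow> ranked_last S (P i) z" for z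
    using True
    by (intro ranked_last_moves_up_eq[OF profiles_ballot[OF P i] profiles_ballot[OF Q i] mv S]) auto
  hence "ranked_last S (Q j) z \<longleftrightarrow> ranked_last S (P j) z" if "j \<in> voters n" for j z
    using rest[of j] that by (cases "j = i") auto
  hence "num_last S n Q = num_last S n P"
    unfolding num_last_def by (intro ext arg_cong[where f = card]) blast
  thus ?thesis by (simp add: least_unpopular_def)
next
  case False
  \<comment> \<open>Voter \<open>i\<close> ranks \<open>x\<close> last in \<open>S\<close> before
    the move but not after it, and no other ballot changes.\<close>
  have x_less: "num_last S n Q x < num_last S n P x"
    unfolding num_last_def
  proof (rule psubset_card_mono)
    have "ranked_last S (P j) x" if "j \<in> voters n" "ranked_last S (Q j) x" for j
      using rest[of j] that False by (cases "j = i") auto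
    thus "{j \<in> voters n. ranked_last S (Q j) x} \<subset> {j \<in> voters n. ranked_last S (P j) x}"
      using False i by blast
  qed simp
  \<comment> \<open>On ballot \<open>i\<close> the last place belonged to \<open>x\<close>, so no
    other alternative can lose one.\<close>
  have others_le: "num_last S n P y \<le> num_last S n Q y" if "y \<noteq> x" for y
    unfolding num_last_def
  proof (rule card_mono)
    have "\<not> ranked_last S (P i) y"
      using False that ranked_last_unique[OF profiles_ballot[OF P i]] by blast
    thus "{j \<in> voters n. ranked_last S (P j) y} \<subseteq> {j \<in> voters n. ranked_last S (Q j) y}"
      using rest by fastforce
  qed simp
  have "num_last S n Q x < num_last S n Q y" if "y \<in> S" "y \<noteq> x" for y
    using x x_less others_le[OF that(2)] that(1) by (fastforce simp: least_unpopular_def)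
  moreover have "x \<in> S" using x by (simp add: least_unpopular_def)
  ultimately show ?thesis
    using least_unpopular_eq_singletonI by metis
qed

lemma LUR_monotonicity:
  assumes "finite A"
  shows "monotonicity A n (LUR A n)"
  unfolding monotonicity_def
proof (intro ballI impI)
  fix P Q x i
  assume P: "P \<in> profiles A n" and Q: "Q \<in> profiles A n" and x: "x \<in> LUR A n P"
    and i: "i \<in> voters n"
    and "moves_up x (P i) (Q i) \<and> (\<forall>j\<in>voters n - {i}. Q j = P j)"
  note step = least_unpopular_moves_up[OF P Q i, of x]
  \<comment> \<open>The two runs proceed in parallel until the one for \<open>Q\<close> possibly
    collapses to \<open>{x}\<close>, where it then remains.\<close>
  have "LUR_stage A n Q k = LUR_stage A n P k \<or> LUR_stage A n Q k = {x}"
    if "x \<in> LUR_stage A n P k" for k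
    using that
  proof (induction k)
    case (Suc k)
    hence "x \<in> LUR_stage A n P k" using LUR_stage_Suc_subset[of A n P k] by blast
    with Suc.IH consider "LUR_stage A n Q k = LUR_stage A n P k" | "LUR_stage A n Q k = {x}"
      by blast
    thus ?case
    proof cases
      case 1
      thus ?thesis
        using step[OF _ _ finite_LUR_stage[OF assms] LUR_stage_subset] Suc.prems
          \<open>moves_up x (P i) (Q i) \<and> _\<close>
        unfolding LUR_stage_Suc by metis
    next
      case 2
      thus ?thesis
        using least_unpopular_eq_singletonI[of x "{x}" n Q] by (simp add: LUR_stage_Suc)
    qed
  qed simp
  thus "x \<in> LUR A n Q" using x unfolding LUR_def by blast
qed

subsection \<open>Counterexamples\<close>

definition ballot3 :: "'a \<Rightarrow> 'a \<Rightarrow> 'a \<Rightarrow> 'a ballot" where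
  "ballot3 a b c = {(a, b), (a, c), (b, c)}"

text \<open>Voters are numbered from 1 and list positions from 0, hence the shift. The restriction
  to \<open>voters\<close> makes the function extensional, as \<open>profiles\<close>
  demands.\<close>

definition profile_of_list :: "'a ballot list \<Rightarrow> 'a profile" where
  "profile_of_list rs = (\<lambda>i\<in>voters (length rs). rs ! (i - 1))"

text \<open>The set is a variable \<open>A\<close> because a ballot may list the alternatives in
  another order than the set does.\<close>

lemma ballot3_in_ballots:
  assumes "distinct [a, b, c]" "A = {a, b, c}"
  shows "ballot3 a b c \<in> ballots A"
  using assms
  by (auto simp: ballots_def ballot3_def strict_linear_order_on_def trans_def irrefl_def
      total_on_def)

lemma ranked_last_ballot3:
  assumes "distinct [a, b, c]" "A = {a, b, c}"
  shows "ranked_last A (ballot3 a b c) x \<longleftrightarrow> x = c"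
  using assms by (auto simp: ranked_last_def ballot3_def)

lemma profile_of_list_in_profiles:
  assumes "set rs \<subseteq> ballots A" "n = length rs"
  shows "profile_of_list rs \<in> profiles A n"
  using assms nth_mem by (fastforce simp: profile_of_list_def profiles_def voters_def)

text \<open>\<open>Suc\<close> is a bijection from list positions to voters; counts of voters
  thereby become lengths of filtered lists, which can be evaluated.\<close>

lemma card_voters_profile_of_list:
  assumes "n = length rs"
  shows "card {i \<in> voters n. p (profile_of_list rs i)} = length (filter p rs)"
proof -
  have "{i \<in> voters n. p (profile_of_list rs i)} = Suc ` {i. i < length rs \<and> p (rs ! i)}"
    using assms
    by (fastforce simp: profile_of_list_def voters_def image_iff Suc_le_eq gr0_conv_Suc)
  thus ?thesis by (simp add: card_image length_filter_conv_card)
qed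

lemma num_above_profile_of_list:
  "n = length rs \<Longrightarrow> num_above n x y (profile_of_list rs) = length (filter (\<lambda>r. (x, y) \<in> r) rs)"
  unfolding num_above_def by (rule card_voters_profile_of_list)

lemma num_last_profile_of_list:
  "n = length rs \<Longrightarrow>
    num_last A n (profile_of_list rs) x = length (filter (\<lambda>r. ranked_last A r x) rs)"
  unfolding num_last_def by (rule card_voters_profile_of_list)

lemma LUR_not_condorcet_winner_criterion:
  "\<not> condorcet_winner_criterion {0, 1, 2 :: nat} 3 (LUR {0, 1, 2} 3)"
proof -
  let ?A = "{0, 1, 2 :: nat}"
  \<comment> \<open>A majority of two puts 0 first, which makes it the Condorcet winner, but the
    third voter puts it last, whereas 1 is never last.\<close>
  let ?P = "profile_of_list [ballot3 0 1 2, ballot3 0 1 2, ballot3 1 2 (0 :: nat)]"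
  have "LUR ?A 3 ?P = {1}"
    by (rule LUR_eq_singletonI)
      (auto simp: num_last_profile_of_list ranked_last_ballot3 insert_commute)
  moreover have "condorcet_winner ?A 3 ?P 0"
    by (auto simp: condorcet_winner_def weakly_unbeaten_def num_above_profile_of_list ballot3_def)
  moreover have "?P \<in> profiles ?A 3"
    by (rule profile_of_list_in_profiles) (auto intro!: ballot3_in_ballots)
  ultimately show ?thesis
    unfolding condorcet_winner_criterion_def by fastforce
qed

lemma LUR_not_condorcet_loser_criterion:
  "\<not> condorcet_loser_criterion {0, 1, 2 :: nat} 5 (LUR {0, 1, 2} 5)"
proof -
  let ?A = "{0, 1, 2 :: nat}"
  \<comment> \<open>Here 0 loses to both rivals by 2 to 3, but it is last only once, while 1 and 2
    are last twice each.\<close>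
  let ?P = "profile_of_list [ballot3 1 2 0, ballot3 2 0 1, ballot3 2 0 1, ballot3 1 0 2,
    ballot3 1 0 (2 :: nat)]"
  have "LUR ?A 5 ?P = {0}"
    by (rule LUR_eq_singletonI)
      (auto simp: num_last_profile_of_list ranked_last_ballot3 insert_commute)
  moreover have "condorcet_loser ?A 5 ?P 0"
    by (auto simp: condorcet_loser_def num_above_profile_of_list ballot3_def)
  moreover have "?P \<in> profiles ?A 5"
    by (rule profile_of_list_in_profiles) (auto intro!: ballot3_in_ballots)
  ultimately show ?thesis
    unfolding condorcet_loser_criterion_def by fastforce
qed

lemma LUR_not_independence_of_irrelevant_alternatives:
  "\<not> independence_of_irrelevant_alternatives {0, 1, 2 :: nat} 2 (LUR {0, 1, 2} 2)"
proof -
  let ?A = "{0, 1, 2 :: nat}"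
  \<comment> \<open>Only 2 changes its position between the profiles. It takes the last place from 1
    on the first ballot and yields it to 0 on the second, so the one alternative never ranked last
    changes from 0 to 1.\<close>
  let ?P = "profile_of_list [ballot3 0 2 1, ballot3 1 0 (2 :: nat)]"
  let ?Q = "profile_of_list [ballot3 0 1 2, ballot3 1 2 (0 :: nat)]"
  have "LUR ?A 2 ?P = {0}" "LUR ?A 2 ?Q = {1}"
    by (rule LUR_eq_singletonI;
        auto simp: num_last_profile_of_list ranked_last_ballot3 insert_commute)+
  moreover have "?P \<in> profiles ?A 2" "?Q \<in> profiles ?A 2"
    by (rule profile_of_list_in_profiles; auto intro!: ballot3_in_ballots)+
  moreover have "\<forall>i\<in>voters 2. (0, 1) \<in> ?P i \<longleftrightarrow> (0, 1) \<in> ?Q i"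
    by (auto simp: profile_of_list_def voters_def ballot3_def nth_Cons split: nat.splits)
  ultimately have "0 \<in> LUR ?A 2 ?P \<and> 1 \<notin> LUR ?A 2 ?P \<and> 1 \<in> LUR ?A 2 ?Q \<and> ?P \<in> profiles ?A 2 \<and>
      ?Q \<in> profiles ?A 2 \<and> (\<forall>i\<in>voters 2. (0, 1) \<in> ?P i \<longleftrightarrow> (0, 1) \<in> ?Q i)"
    by simp
  thus ?thesis
    unfolding independence_of_irrelevant_alternatives_def by blast
qed

theorem proposition5:
  shows "(\<forall>(A :: 'a set) n. finite A \<and> card A \<ge> 3 \<and> n \<ge> 1 \<longrightarrow>
            always_a_winner A n (LUR A n) \<and>
            monotonicity A n (LUR A n) \<and>
            pareto A n (LUR A n) \<and>
            social_disappointment_criterion A n (LUR A n)) \<and>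
         (\<exists>(A :: nat set) n. finite A \<and> card A \<ge> 3 \<and> n \<ge> 1 \<and>
            \<not> condorcet_winner_criterion A n (LUR A n)) \<and>
         (\<exists>(A :: nat set) n. finite A \<and> card A \<ge> 3 \<and> n \<ge> 1 \<and>
            \<not> condorcet_loser_criterion A n (LUR A n)) \<and>
         (\<exists>(A :: nat set) n. finite A \<and> card A \<ge> 3 \<and> n \<ge> 1 \<and>
            \<not> independence_of_irrelevant_alternatives A n (LUR A n))"
proof (intro conjI allI impI)
  fix A :: "'a set" and n :: nat
  assume asm: "finite A \<and> card A \<ge> 3 \<and> n \<ge> 1"
  hence "A \<noteq> {}" by auto
  with asm show "always_a_winner A n (LUR A n)" "monotonicity A n (LUR A n)"
    "pareto A n (LUR A n)" "social_disappointment_criterion A n (LUR A n)"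
    by (simp_all add: LUR_always_a_winner LUR_monotonicity LUR_pareto
        LUR_social_disappointment_criterion)
next
  show "\<exists>(A :: nat set) n. finite A \<and> card A \<ge> 3 \<and> n \<ge> 1 \<and>
      \<not> condorcet_winner_criterion A n (LUR A n)"
    by (intro exI[of _ "{0, 1, 2}"] exI[of _ 3] conjI LUR_not_condorcet_winner_criterion) simp_all
  show "\<exists>(A :: nat set) n. finite A \<and> card A \<ge> 3 \<and> n \<ge> 1 \<and>
      \<not> condorcet_loser_criterion A n (LUR A n)"
    by (intro exI[of _ "{0, 1, 2}"] exI[of _ 5] conjI LUR_not_condorcet_loser_criterion) simp_all
  show "\<exists>(A :: nat set) n. finite A \<and> card A \<ge> 3 \<and> n \<ge> 1 \<and>
      \<not> independence_of_irrelevant_alternatives A n (LUR A n)"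
    by (intro exI[of _ "{0, 1, 2}"] exI[of _ 2] conjI
        LUR_not_independence_of_irrelevant_alternatives) simp_all
qed

end
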